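(* For every $\rho>0$ there exists a sequence $(z_k)_{k\in\mathbb{N}}$ of distinct numbers in the unit disc $\mathbb{D}$ with the following properties: (i) there is a constant $C>0$ such that $N_{z_k}\bigl(\frac{1-|z_k|}{2}\bigr)\le C\bigl(\frac{1}{1-|z_k|}\bigr)^{\rho}$ for all $k\in\mathbb{N}$; (ii) for every $\varepsilon_0>0$ and every analytic function $a$ in $\mathbb{D}$ for which there is a constant $C'>0$ with $\ln M(r,a)\le C'(1-r)^{-\rho+\varepsilon_0}$ for all $r\in[0,1)$, the sequence $(z_k)$ is not the zero sequence of any solution $f$ of the differential equation $f''+a(z)f=0$ in $\mathbb{D}$.
   Context: $\mathbb{D}=\{z\in\mathbb{C}:|z|<1\}$. For $g$ analytic in $\mathbb{D}$ and $r\in[0,1)$, $M(r,g)=\max\{|g(z)|:|z|=r\}$ (with $\ln 0=-\infty$). For a sequence $(z_k)$ in $\mathbb{D}$, $\zeta\in\mathbb{D}$ and $t\ge0$, $n_\zeta(t)$ is the number of members $z_k$ of the sequence with $|z_k-\zeta|\le t$, and $N_\zeta(r)=\int_0^r\frac{(n_\zeta(t)-1)^+}{t}\,dt$, where $x^+=\max\{x,0\}$. Saying that $(z_k)$ is the zero sequence of a solution $f$ means that $f$ is analytic in $\mathbb{D}$, not identically zero, and its zeros are precisely the points $z_k$. *)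

theory Defs
  imports "HOL-Analysis.Analysis"
begin

abbreviation unit_disc :: "complex set" where
  "unit_disc \<equiv> ball 0 1"

(* For g analytic in the unit disc and 0 \<le> r < 1 the supremum is a maximum,
   by compactness of the circle. *)
definition max_modulus :: "real \<Rightarrow> (complex \<Rightarrow> complex) \<Rightarrow> real" where
  "max_modulus r g = (SUP w\<in>sphere 0 r. cmod (g w))"

(* The real function ln has the junk value ln 0 = 0, so the convention
   ln 0 = -\<infinity> is spelled out in the extended reals. *)
definition ln_max_modulus :: "real \<Rightarrow> (complex \<Rightarrow> complex) \<Rightarrow> ereal" where
  "ln_max_modulus r g =
     (if max_modulus r g = 0 then -\<infinity> else ereal (ln (max_modulus r g)))"

(* Counts indices k. The value is extended so that infinitely many members of
   the sequence in a closed disc give \<infinity>; card would give 0 there. *)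
definition counting :: "(nat \<Rightarrow> complex) \<Rightarrow> complex \<Rightarrow> real \<Rightarrow> ennreal" where
  "counting z \<zeta> t = emeasure (count_space UNIV) {k. cmod (z k - \<zeta>) \<le> t}"

(* Subtraction on ennreal is truncated at 0 (and \<infinity> - 1 = \<infinity>),
   so counting z \<zeta> t - 1 is the positive part of n(t) - 1. *)
definition integrated_counting :: "(nat \<Rightarrow> complex) \<Rightarrow> complex \<Rightarrow> real \<Rightarrow> ennreal" where
  "integrated_counting z \<zeta> r =
     (\<integral>\<^sup>+t\<in>{0<..r}. ((counting z \<zeta> t - 1) / ennreal t) \<partial>lborel)"

definition solution_in_disc :: "(complex \<Rightarrow> complex) \<Rightarrow> (complex \<Rightarrow> complex) \<Rightarrow> bool" where
  "solution_in_disc a f \<longleftrightarrow>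
     f analytic_on unit_disc \<and> (\<forall>w\<in>unit_disc. deriv (deriv f) w + a w * f w = 0)"

(* No multiplicities: a nontrivial solution of f'' + a f = 0 has only simple zeros. *)
definition zero_sequence_of :: "(nat \<Rightarrow> complex) \<Rightarrow> (complex \<Rightarrow> complex) \<Rightarrow> bool" where
  "zero_sequence_of z f \<longleftrightarrow>
     (\<exists>w\<in>unit_disc. f w \<noteq> 0) \<and> {w \<in> unit_disc. f w = 0} = range z"

end

theory Submission
  imports Defs "HOL-Complex_Analysis.Cauchy_Integral_Formula"
begin

text \<open>
  A differential equation $f'' + a f = 0$ with a bounded coefficient cannot have two zeros of a
  nontrivial solution arbitrarily close together: as in Sturm's comparison theorem, two zeros at
  distance $\delta$ force $|a| \geq 2/\delta^2$ somewhere on the segment between them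
  (\<open>close_zeros_force_large_coefficient\<close>). The counting condition, on the other hand, depends
  on the distance $\delta$ only through the logarithm $\ln (1/\delta)$. So the two conditions
  separate for a sequence of very tight pairs, the pairs themselves lying far apart.

  Put the $n$-th pair on the radius $(0,1)$ at distance $s_n = 4^{-(n+1)}$ from the boundary, with gap
  $\delta_n = \frac{s_n}{4} \exp(-s_n^{-\rho})$. The disc of radius $(1 - |z_k|)/2$ about $z_k$
  contains only $z_k$ and its partner, so the integrated counting function is
  $\ln \frac{1-|z_k|}{2 \delta_n}$, which is of order $s_n^{-\rho}$
  (\<open>integrated_counting_pair_sequence\<close>).
  If the sequence were the zero sequence of a solution, there would be points at distance comparable to $s_n$
  from the boundary where $\ln |a| \geq 2 s_n^{-\rho}$, whereas the growth condition gives
  $\ln |a| = O(s_n^{-\rho+\varepsilon})$ there. Comparing the two bounds yields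
  $2 = O(s_n^\varepsilon)$ (\<open>pair_sequence_coefficient_lower_bound\<close>), which is absurd since
  $s_n \to 0$.
\<close>

section \<open>Distance of two zeros of a solution\<close>

text \<open>
  Rolle's theorem fails for complex-valued functions, so the argument passes to a real function.
  Parametrise the segment affinely by $[0,1]$ and let $|f|$ attain its maximum $m$ over it at
  parameter $c$. The function $u = \mathrm{Re}\,(\overline{f(c)} f)$ satisfies $u \leq m^2 = u(c)$, so
  $c$ is an interior critical point of $u$. Taylor's formula at $c$, evaluated at the parameter $0$
  where $u$ vanishes, gives $m^2 = -\frac12 u''(t) c^2$ for some $t$. Here
  $|u''| \leq |a| m^2 |p-q|^2$ by the equation and the maximality of $m$, and the factor $m^2$ cancels.
\<close>

lemma close_zeros_force_large_coefficient:
  fixes f a :: "complex \<Rightarrow> complex"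
  assumes analytic: "f analytic_on closed_segment p q"
    and ode: "\<And>w. w \<in> closed_segment p q \<Longrightarrow> deriv (deriv f) w + a w * f w = 0"
    and zeros: "f p = 0" "f q = 0"
    and nontrivial: "\<exists>w\<in>closed_segment p q. f w \<noteq> 0"
  shows "\<exists>w\<in>closed_segment p q. 2 \<le> cmod (a w) * (dist p q)\<^sup>2"
proof -
  define l where "l t = p + of_real t * (q - p)" for t :: real
  have l_eq: "l t = (1 - t) *\<^sub>R p + t *\<^sub>R q" for t
    by (simp add: l_def scaleR_conv_of_real algebra_simps)
  have l_seg: "l t \<in> closed_segment p q" if "0 \<le> t" "t \<le> 1" for t
    using that unfolding l_eq closed_segment_def by blast
  have f_diff: "(f has_field_derivative deriv f w) (at w)" if "w \<in> closed_segment p q" for w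
    using analytic that
    by (simp add: analytic_on_imp_differentiable_at DERIV_deriv_iff_field_differentiable)
  have f'_diff: "(deriv f has_field_derivative deriv (deriv f) w) (at w)"
    if "w \<in> closed_segment p q" for w
    using analytic_deriv[OF analytic] that
    by (simp add: analytic_on_imp_differentiable_at DERIV_deriv_iff_field_differentiable)
  have l_diff: "(l has_vector_derivative (q - p)) (at t)" for t
    unfolding l_def by (auto intro!: derivative_eq_intros)
  have "continuous_on {0..1} (\<lambda>t. cmod (f (l t)))"
  proof (intro continuous_intros)
    show "continuous_on {0..1} (\<lambda>t. f (l t))"
    proof (rule continuous_on_compose2[of "closed_segment p q" f])
      show "continuous_on (closed_segment p q) f"
        using analytic by (intro holomorphic_on_imp_continuous_on analytic_imp_holomorphic)
      show "continuous_on {0..1} l" unfolding l_def by (intro continuous_intros)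
    qed (use l_seg in auto)
  qed
  then obtain c where c: "c \<in> {0..1}" and c_max: "\<And>t. t \<in> {0..1} \<Longrightarrow> cmod (f (l t)) \<le> cmod (f (l c))"
    using continuous_attains_sup[of "{0..1::real}" "\<lambda>t. cmod (f (l t))"] by fastforce
  define m where "m = cmod (f (l c))"
  obtain w0 where "w0 \<in> closed_segment p q" "f w0 \<noteq> 0" using nontrivial by blast
  then obtain t0 where "t0 \<in> {0..1}" "f (l t0) \<noteq> 0"
    unfolding closed_segment_def l_eq by auto
  then have m_pos: "m > 0"
    using c_max[of t0] unfolding m_def by (auto intro: less_le_trans[of 0 "cmod (f (l t0))"])
  have "c \<noteq> 0" "c \<noteq> 1" using m_pos zeros unfolding m_def l_def by auto
  then have c_in: "0 < c" "c < 1" using c by auto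

  \<comment> \<open>The real function to which Taylor's formula applies, and its first two derivatives.\<close>
  define u where "u t = Re (cnj (f (l c)) * f (l t))" for t
  define u1 where "u1 t = Re (cnj (f (l c)) * ((q - p) * deriv f (l t)))" for t
  define u2 where "u2 t = Re (cnj (f (l c)) * ((q - p) * ((q - p) * deriv (deriv f) (l t))))" for t
  have u_diff: "(u has_field_derivative u1 t) (at t)" if "0 \<le> t" "t \<le> 1" for t
  proof -
    have "((\<lambda>t. f (l t)) has_vector_derivative (q - p) * deriv f (l t)) (at t)"
      using field_vector_diff_chain_at[OF l_diff f_diff[OF l_seg[OF that]]] by (simp add: o_def)
    then show ?thesis unfolding u_def u1_def has_real_derivative_iff_has_vector_derivative
      by (intro derivative_eq_intros has_vector_derivative_mult_right
                bounded_linear.has_vector_derivative[OF bounded_linear_Re])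
  qed
  have u1_diff: "(u1 has_field_derivative u2 t) (at t)" if "0 \<le> t" "t \<le> 1" for t
  proof -
    have "((\<lambda>t. deriv f (l t)) has_vector_derivative (q - p) * deriv (deriv f) (l t)) (at t)"
      using field_vector_diff_chain_at[OF l_diff f'_diff[OF l_seg[OF that]]] by (simp add: o_def)
    then show ?thesis unfolding u1_def u2_def has_real_derivative_iff_has_vector_derivative
      by (intro derivative_eq_intros has_vector_derivative_mult_right
                bounded_linear.has_vector_derivative[OF bounded_linear_Re])
  qed
  have u_c: "u c = m\<^sup>2"
    unfolding u_def m_def by (metis Re_complex_of_real complex_norm_square mult.commute)
  have re_le: "\<bar>Re (cnj (f (l c)) * w)\<bar> \<le> m * cmod w" for w
    using abs_Re_le_cmod[of "cnj (f (l c)) * w"] by (simp add: m_def norm_mult)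
  have u_le: "u t \<le> u c" if "0 \<le> t" "t \<le> 1" for t
  proof -
    have "u t \<le> m * cmod (f (l t))" unfolding u_def using re_le[of "f (l t)"] by linarith
    also have "\<dots> \<le> m * m" using c_max[of t] that m_pos unfolding m_def by (intro mult_left_mono) auto
    finally show ?thesis by (simp add: u_c power2_eq_square)
  qed
  have "u1 c = 0"
  proof (rule DERIV_local_max)
    show "DERIV u c :> u1 c" using u_diff c_in by simp
    show "0 < min c (1 - c)" using c_in by simp
    show "\<forall>y. \<bar>c - y\<bar> < min c (1 - c) \<longrightarrow> u y \<le> u c" using u_le by (auto simp: abs_if split: if_splits)
  qed
  have "\<exists>t. 0 < t \<and> t < c \<and>
    u 0 = (\<Sum>i<2. (case i of 0 \<Rightarrow> u | Suc 0 \<Rightarrow> u1 | _ \<Rightarrow> u2) c / fact i * (0 - c) ^ i)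
        + (case (2::nat) of 0 \<Rightarrow> u | Suc 0 \<Rightarrow> u1 | _ \<Rightarrow> u2) t / fact 2 * (0 - c) ^ 2"
  proof (rule Taylor_down)
    show "\<forall>i t. i < (2::nat) \<and> 0 \<le> t \<and> t \<le> 1 \<longrightarrow>
      DERIV ((case i of 0 \<Rightarrow> u | Suc 0 \<Rightarrow> u1 | _ \<Rightarrow> u2)) t :>
            (case Suc i of 0 \<Rightarrow> u | Suc 0 \<Rightarrow> u1 | _ \<Rightarrow> u2) t"
      using u_diff u1_diff by (auto simp: numeral_2_eq_2 less_Suc_eq)
  qed (use c_in in auto)
  then obtain t where t: "0 < t" "t < c" and "u 0 = u c - u1 c * c + u2 t / 2 * c\<^sup>2"
    by (auto simp: numeral_2_eq_2)
  then have taylor: "m\<^sup>2 = - u2 t / 2 * c\<^sup>2"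
    using zeros(1) \<open>u1 c = 0\<close> by (simp add: u_c) (simp add: u_def l_def)
  have t_in: "t \<in> {0..1}" using t c_in by auto
  have d2: "deriv (deriv f) (l t) = - (a (l t) * f (l t))"
    using ode[OF l_seg[of t]] t_in by (simp add: eq_neg_iff_add_eq_0)
  have "- u2 t \<le> m * cmod ((q - p) * ((q - p) * deriv (deriv f) (l t)))"
    unfolding u2_def using re_le[of "(q - p) * ((q - p) * deriv (deriv f) (l t))"] by linarith
  also have "\<dots> = m * (cmod (a (l t)) * (dist p q)\<^sup>2 * cmod (f (l t)))"
    by (simp add: d2 norm_mult dist_norm norm_minus_commute power2_eq_square)
  also have "\<dots> \<le> m * (cmod (a (l t)) * (dist p q)\<^sup>2 * m)"
    using c_max[OF t_in] m_pos by (intro mult_left_mono) (auto simp: m_def)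
  finally have u2_le: "- u2 t \<le> m\<^sup>2 * (cmod (a (l t)) * (dist p q)\<^sup>2)"
    by (simp add: power2_eq_square mult_ac)
  have "m\<^sup>2 \<le> m\<^sup>2 * (cmod (a (l t)) * (dist p q)\<^sup>2) / 2 * c\<^sup>2"
    unfolding taylor[THEN arg_cong[where f="\<lambda>x. x \<le> _"]]
    using u2_le by (intro mult_right_mono) auto
  also have "\<dots> \<le> m\<^sup>2 * (cmod (a (l t)) * (dist p q)\<^sup>2) / 2 * 1"
    using c_in by (intro mult_left_mono) (auto simp: power_le_one)
  finally have "2 \<le> cmod (a (l t)) * (dist p q)\<^sup>2"
    using m_pos by (simp add: field_simps)
  then show ?thesis using l_seg[of t] t_in by auto
qed

section \<open>Counting function of an isolated pair\<close>

text \<open>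
  In the situation below $(n_\zeta(t) - 1)^+$ is $0$ for $t < \delta$ and at most $1$ for
  $\delta \leq t \leq r$, so the integral is at most $\int_\delta^r dt/t$.
\<close>

lemma integrated_counting_le_ln:
  assumes gap: "0 < \<delta>" "\<delta> \<le> r"
    and nearest: "\<And>k. k \<noteq> i \<Longrightarrow> \<delta> \<le> cmod (z k - \<zeta>)"
    and others: "\<And>k. k \<noteq> i \<Longrightarrow> k \<noteq> j \<Longrightarrow> r < cmod (z k - \<zeta>)"
  shows "integrated_counting z \<zeta> r \<le> ennreal (ln (r / \<delta>))"
proof -
  have sub_le: "emeasure (count_space UNIV) A \<le> ennreal (real (card B))" if "A \<subseteq> B" "finite B" for A B :: "nat set"
  proof -
    have "finite A" using that finite_subset by blast
    then show ?thesis using that by (simp add: card_mono ennreal_of_nat_eq_real_of_nat)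
  qed
  have bound: "(counting z \<zeta> t - 1) / ennreal t * indicator {0<..r} t
      \<le> ennreal (1 / t) * indicator {\<delta>..r} t" for t
  proof (cases "0 < t \<and> t \<le> r")
    case True
    show ?thesis
    proof (cases "\<delta> \<le> t")
      case gt: True
      have "{k. cmod (z k - \<zeta>) \<le> t} \<subseteq> {i, j}" using others True by fastforce
      then have "counting z \<zeta> t \<le> ennreal (real (card {i, j}))" unfolding counting_def by (rule sub_le) simp
      also have "\<dots> \<le> ennreal 2" by (intro ennreal_leI) (simp add: card_insert_if)
      finally have "counting z \<zeta> t - 1 \<le> ennreal 2 - ennreal 1" by (simp add: ennreal_minus_mono)
      also have "\<dots> = 1" by (subst ennreal_minus) auto
      finally have "(counting z \<zeta> t - 1) / ennreal t \<le> ennreal 1 / ennreal t"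
        by (simp add: divide_right_mono_ennreal)
      then show ?thesis using True gt divide_ennreal[of 1 t] by simp
    next
      case lt: False
      have "{k. cmod (z k - \<zeta>) \<le> t} \<subseteq> {i}" using nearest lt by fastforce
      then have "counting z \<zeta> t \<le> ennreal (real (card {i}))" unfolding counting_def by (rule sub_le) simp
      then have "counting z \<zeta> t - 1 \<le> 1 - 1" by (intro ennreal_minus_mono) auto
      then show ?thesis by simp
    qed
  qed auto
  have "integrated_counting z \<zeta> r \<le> (\<integral>\<^sup>+t. ennreal (1 / t) * indicator {\<delta>..r} t \<partial>lborel)"
    unfolding integrated_counting_def by (intro nn_integral_mono bound)
  also have "\<dots> = ennreal (ln r - ln \<delta>)"
    by (rule nn_integral_FTC_Icc) (use gap in \<open>auto intro!: derivative_eq_intros\<close>)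
  also have "ln r - ln \<delta> = ln (r / \<delta>)" using gap by (simp add: ln_div)
  finally show ?thesis .
qed

section \<open>A sequence of tight pairs\<close>

definition block_scale :: "nat \<Rightarrow> real" where
  "block_scale n = 1 / 4 ^ (n + 1)"

text \<open>
  The exponential makes $\ln (1/\delta_n)$ of order $s_n^{-\rho}$, which is as large as the counting
  condition permits. The factor $s_n/4$ keeps the two members of a pair close together compared
  with $s_n$, and hence the pairs apart from each other, for every $\rho$.
\<close>

definition pair_gap :: "real \<Rightarrow> nat \<Rightarrow> real" where
  "pair_gap \<rho> n = block_scale n / 4 * exp (- (block_scale n powr (- \<rho>)))"

text \<open>
  The indices $2n$ and $2n+1$ form the $n$-th pair. All points are positive reals, so $1 - |z_k|$
  determines $z_k$.
\<close>

definition boundary_distance :: "real \<Rightarrow> nat \<Rightarrow> real" where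
  "boundary_distance \<rho> k =
     block_scale (k div 2) - (if even k then 0 else pair_gap \<rho> (k div 2))"

definition pair_sequence :: "real \<Rightarrow> nat \<Rightarrow> complex" where
  "pair_sequence \<rho> k = of_real (1 - boundary_distance \<rho> k)"

lemma block_scale_pos: "0 < block_scale n"
  and block_scale_le: "block_scale n \<le> 1 / 4"
  by (auto simp: block_scale_def field_simps)

lemma block_scale_decay:
  assumes "m < n" shows "block_scale n \<le> block_scale m / 4"
proof -
  have "(4::real) ^ (m + 2) \<le> 4 ^ (n + 1)" using assms by (intro power_increasing) auto
  then show ?thesis by (simp add: block_scale_def field_simps)
qed

lemma block_scale_tendsto: "block_scale \<longlonglongrightarrow> 0"
proof -
  have "(\<lambda>n. (1/4::real) ^ Suc n) \<longlonglongrightarrow> 0"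
    by (intro LIMSEQ_Suc LIMSEQ_realpow_zero) auto
  then show ?thesis by (simp add: block_scale_def[abs_def] power_one_over)
qed

lemma pair_gap_pos: "0 < pair_gap \<rho> n"
  using block_scale_pos[of n] by (simp add: pair_gap_def)

lemma pair_gap_less: "pair_gap \<rho> n < block_scale n / 4"
  using block_scale_pos[of n] by (simp add: pair_gap_def)

lemma boundary_distance_bounds:
  "3 / 4 * block_scale (k div 2) < boundary_distance \<rho> k"
  "boundary_distance \<rho> k \<le> block_scale (k div 2)"
  using pair_gap_pos[of \<rho> "k div 2"] pair_gap_less[of \<rho> "k div 2"] block_scale_pos[of "k div 2"]
  by (auto simp: boundary_distance_def)

lemma boundary_distance_pos: "0 < boundary_distance \<rho> k"
  using boundary_distance_bounds(1)[of k \<rho>] block_scale_pos[of "k div 2"] by linarith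

lemma norm_pair_sequence: "cmod (pair_sequence \<rho> k) = 1 - boundary_distance \<rho> k"
  unfolding pair_sequence_def norm_of_real
  using boundary_distance_bounds(2)[of \<rho> k] block_scale_le[of "k div 2"] by simp

lemma pair_sequence_diff:
  "cmod (pair_sequence \<rho> j - pair_sequence \<rho> k) = \<bar>boundary_distance \<rho> j - boundary_distance \<rho> k\<bar>"
  unfolding pair_sequence_def of_real_diff[symmetric] norm_of_real by simp

text \<open>
  A pair with scale $s$ has its boundary distances in $(\frac34 s, s]$, and a later pair in
  $(0, \frac14 s]$. The difference exceeds $\frac12 s$, hence half of either boundary distance.
\<close>

lemma pair_sequence_separated:
  assumes "j div 2 \<noteq> k div 2"
  shows "boundary_distance \<rho> k / 2 < cmod (pair_sequence \<rho> j - pair_sequence \<rho> k)"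
proof -
  note b = boundary_distance_bounds(1)[of j \<rho>] boundary_distance_bounds(1)[of k \<rho>]
    boundary_distance_bounds(2)[of \<rho> j] boundary_distance_bounds(2)[of \<rho> k]
    block_scale_pos[of "j div 2"] block_scale_pos[of "k div 2"]
  consider "j div 2 < k div 2" | "k div 2 < j div 2" using assms by linarith
  then show ?thesis
    unfolding pair_sequence_diff
    by cases (use b block_scale_decay in \<open>fastforce+\<close>)
qed

lemma pair_sequence_partner:
  assumes "j div 2 = k div 2" "j \<noteq> k"
  shows "cmod (pair_sequence \<rho> j - pair_sequence \<rho> k) = pair_gap \<rho> (k div 2)"
proof -
  have "even j \<longleftrightarrow> odd k" using assms by presburger
  then show ?thesis unfolding pair_sequence_diff
    using pair_gap_pos[of \<rho> "k div 2"] assms(1) by (auto simp: boundary_distance_def)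
qed

lemma inj_pair_sequence: "inj (pair_sequence \<rho>)"
proof (rule injI, rule ccontr)
  fix j k assume eq: "pair_sequence \<rho> j = pair_sequence \<rho> k" and "j \<noteq> k"
  then show False
    using pair_sequence_partner[of j k \<rho>] pair_gap_pos[of \<rho> "k div 2"]
      pair_sequence_separated[of j k \<rho>] boundary_distance_pos[of \<rho> k]
    by (cases "j div 2 = k div 2") auto
qed

lemma integrated_counting_pair_sequence:
  assumes "\<rho> > 0"
  shows "integrated_counting (pair_sequence \<rho>) (pair_sequence \<rho> k) ((1 - cmod (pair_sequence \<rho> k)) / 2)
    \<le> ennreal (2 * (1 / (1 - cmod (pair_sequence \<rho> k))) powr \<rho>)"
proof -
  define s d where "s = block_scale (k div 2)" and "d = boundary_distance \<rho> k"
  define \<delta> where "\<delta> = pair_gap \<rho> (k div 2)"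
  have s: "0 < s" "s \<le> 1 / 4" unfolding s_def by (rule block_scale_pos block_scale_le)+
  have d: "3 / 4 * s < d" "d \<le> s" unfolding s_def d_def by (rule boundary_distance_bounds)+
  have \<delta>: "0 < \<delta>" "\<delta> < s / 4" unfolding s_def \<delta>_def by (rule pair_gap_pos pair_gap_less)+
  have far: "d / 2 < cmod (pair_sequence \<rho> j - pair_sequence \<rho> k)" if "j div 2 \<noteq> k div 2" for j
    unfolding d_def using that by (rule pair_sequence_separated)
  define k' where "k' = (if even k then k + 1 else k - 1)"
  have partner: "j = k \<or> j = k'" if "j div 2 = k div 2" for j
    using that unfolding k'_def by presburger
  have "integrated_counting (pair_sequence \<rho>) (pair_sequence \<rho> k) (d / 2) \<le> ennreal (ln (d / 2 / \<delta>))"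
  proof (rule integrated_counting_le_ln[where i = k and j = k'])
    show "\<delta> \<le> cmod (pair_sequence \<rho> j - pair_sequence \<rho> k)" if "j \<noteq> k" for j
      using that far[of j] pair_sequence_partner[of j k \<rho>] d \<delta>
      by (cases "j div 2 = k div 2") (auto simp: \<delta>_def)
    show "d / 2 < cmod (pair_sequence \<rho> j - pair_sequence \<rho> k)" if "j \<noteq> k" "j \<noteq> k'" for j
      using that far partner by blast
  qed (use d \<delta> s in auto)
  also have "ln (d / 2 / \<delta>) \<le> 2 * (1 / d) powr \<rho>"
  proof -
    have "d / 2 / \<delta> \<le> s / 2 / \<delta>" using d \<delta> by (simp add: divide_right_mono)
    also have "\<dots> = 2 * exp (s powr (- \<rho>))"
      using s unfolding \<delta>_def pair_gap_def s_def[symmetric] by (simp add: exp_minus field_simps)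
    finally have "ln (d / 2 / \<delta>) \<le> ln (2 * exp (s powr (- \<rho>)))" using d s \<delta> by simp
    also have "\<dots> = ln 2 + s powr (- \<rho>)" by (simp add: ln_mult)
    also have "\<dots> \<le> 1 + s powr (- \<rho>)" using ln_le_minus_one[of 2] by simp
    also have "\<dots> \<le> 2 * s powr (- \<rho>)"
      using powr_mono2'[of "- \<rho>" s 1] s assms by simp
    also have "s powr (- \<rho>) \<le> d powr (- \<rho>)" using powr_mono2'[of "- \<rho>" d s] d s assms by simp
    also have "d powr (- \<rho>) = (1 / d) powr \<rho>" using d s by (simp add: powr_divide powr_minus_divide)
    finally show ?thesis by simp
  qed
  finally show ?thesis by (simp add: norm_pair_sequence d_def ennreal_leI)
qed

section \<open>Growth of the coefficient\<close>

lemma ln_norm_le_if_ln_max_modulus_le: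
  assumes "continuous_on (sphere 0 (cmod w)) a" "a w \<noteq> 0"
    and "ln_max_modulus (cmod w) a \<le> ereal B"
  shows "ln (cmod (a w)) \<le> B"
proof -
  have "compact ((\<lambda>v. cmod (a v)) ` sphere 0 (cmod w))"
    using assms(1) by (intro compact_continuous_image continuous_intros) auto
  then have "cmod (a w) \<le> max_modulus (cmod w) a"
    unfolding max_modulus_def
    by (intro cSUP_upper bounded_imp_bdd_above compact_imp_bounded) auto
  moreover from this have "max_modulus (cmod w) a > 0"
    using assms(2) by (metis less_le_trans zero_less_norm_iff)
  ultimately show ?thesis
    using assms(2,3) by (simp add: ln_max_modulus_def) (meson ln_le_cancel_iff order_trans zero_less_norm_iff)
qed

text \<open>
  Compares the lower bound $\ln |a| \geq 2 s^{-\rho}$, forced at a point between the two zeros of a pair,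
  with the assumed growth of $a$ there. That point has boundary distance in $[\frac34 s, s]$; replacing
  this distance by $s$ in $(1-r)^{-\rho}$ costs the factor $(4/3)^\rho$. After division by $s^{-\rho}$
  only a vanishing power of $s$ is left on the right-hand side.
\<close>

lemma pair_sequence_coefficient_lower_bound:
  assumes "\<rho> > 0" and a: "a analytic_on unit_disc" and "C > 0"
    and growth: "\<forall>r\<in>{0..<1}. ln_max_modulus r a \<le> ereal (C * (1 - r) powr (- \<rho> + \<epsilon>))"
    and f: "solution_in_disc a f" "zero_sequence_of (pair_sequence \<rho>) f" and "\<epsilon> > 0"
  shows "2 \<le> C * (4 / 3) powr \<rho> * block_scale n powr \<epsilon>"
proof -
  define s \<delta> where "s = block_scale n" and "\<delta> = pair_gap \<rho> n"
  have s: "0 < s" "s \<le> 1 / 4" unfolding s_def by (rule block_scale_pos block_scale_le)+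
  have \<delta>: "0 < \<delta>" "\<delta> < s / 4" unfolding s_def \<delta>_def by (rule pair_gap_pos pair_gap_less)+
  define p q :: complex where "p = of_real (1 - s)" and "q = of_real (1 - s + \<delta>)"
  have p_eq: "p = pair_sequence \<rho> (2 * n)" and q_eq: "q = pair_sequence \<rho> (2 * n + 1)"
    by (simp_all add: p_def q_def pair_sequence_def boundary_distance_def s_def \<delta>_def algebra_simps)
  have seg: "\<exists>x. w = of_real x \<and> 1 - s \<le> x \<and> x \<le> 1 - s + \<delta>" if "w \<in> closed_segment p q" for w
    using that \<delta> unfolding p_def q_def closed_segment_of_real
    by (auto simp: closed_segment_eq_real_ivl)
  have seg_disc: "closed_segment p q \<subseteq> unit_disc"
  proof
    fix w assume "w \<in> closed_segment p q"
    then obtain x where "w = of_real x" "1 - s \<le> x" "x \<le> 1 - s + \<delta>" using seg by blast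
    then show "w \<in> unit_disc" using s \<delta> by simp
  qed
  have zeros: "{w \<in> unit_disc. f w = 0} = range (pair_sequence \<rho>)"
    using f(2) by (simp add: zero_sequence_of_def)
  have "\<exists>w\<in>closed_segment p q. 2 \<le> cmod (a w) * (dist p q)\<^sup>2"
  proof (rule close_zeros_force_large_coefficient)
    show "f analytic_on closed_segment p q"
      using f(1) seg_disc by (auto simp: solution_in_disc_def intro: analytic_on_subset)
    show "deriv (deriv f) w + a w * f w = 0" if "w \<in> closed_segment p q" for w
      using f(1) seg_disc that by (auto simp: solution_in_disc_def)
    show "f p = 0" "f q = 0" using zeros unfolding p_eq q_eq by blast+
    \<comment> \<open>The zeros are enumerated by a sequence, so they cannot fill a segment.\<close>
    have "uncountable (closed_segment p q)"
      using \<delta> by (intro uncountable_closed_segment) (simp add: p_def q_def)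
    moreover have "countable (range (pair_sequence \<rho>))" by simp
    ultimately show "\<exists>w\<in>closed_segment p q. f w \<noteq> 0"
      using zeros seg_disc by (metis (mono_tags, lifting) countable_subset mem_Collect_eq subset_eq)
  qed
  moreover have "dist p q = \<delta>" unfolding p_def q_def using \<delta> by (simp add: dist_norm)
  ultimately obtain w where w: "w \<in> closed_segment p q" "2 \<le> cmod (a w) * \<delta>\<^sup>2" by auto
  obtain x where x: "w = of_real x" "1 - s \<le> x" "x \<le> 1 - s + \<delta>" using seg w(1) by blast
  have norm_w: "cmod w = x" using x s by simp
  have "a w \<noteq> 0" using w(2) by auto
  have "ln (cmod (a w)) \<le> C * (1 - x) powr (- \<rho> + \<epsilon>)"
  proof (rule ln_norm_le_if_ln_max_modulus_le[where a = a and w = w, OF _ \<open>a w \<noteq> 0\<close>])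
    have "sphere 0 (cmod w) \<subseteq> unit_disc" using x s \<delta> norm_w by auto
    then show "continuous_on (sphere 0 (cmod w)) a"
      using a by (meson analytic_imp_holomorphic analytic_on_subset holomorphic_on_imp_continuous_on)
    show "ln_max_modulus (cmod w) a \<le> ereal (C * (1 - x) powr (- \<rho> + \<epsilon>))"
      using growth x s \<delta> by (simp add: norm_w)
  qed
  also have "\<dots> = C * ((1 - x) powr (- \<rho>) * (1 - x) powr \<epsilon>)" by (simp only: powr_add)
  also have "\<dots> \<le> C * ((3 / 4 * s) powr (- \<rho>) * s powr \<epsilon>)"
    using x s \<delta> \<open>C > 0\<close> \<open>\<rho> > 0\<close> \<open>\<epsilon> > 0\<close>
    by (intro mult_left_mono mult_mono powr_mono2 powr_mono2') auto
  also have "(3 / 4 * s) powr (- \<rho>) = (4 / 3) powr \<rho> * s powr (- \<rho>)"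
    using s by (simp add: powr_mult powr_minus powr_divide field_simps)
  finally have upper: "ln (cmod (a w)) \<le> C * (4 / 3) powr \<rho> * s powr \<epsilon> * s powr (- \<rho>)"
    by (simp add: mult_ac)
  have "\<delta> \<le> 1 * exp (- (s powr (- \<rho>)))"
    unfolding \<delta>_def pair_gap_def s_def[symmetric] using s by (intro mult_right_mono) auto
  then have "\<delta>\<^sup>2 \<le> (exp (- (s powr (- \<rho>))))\<^sup>2" using \<delta> by (intro power_mono) auto
  also have "\<dots> = exp (- (2 * s powr (- \<rho>)))" by (simp add: exp_double[symmetric])
  finally have "cmod (a w) * \<delta>\<^sup>2 \<le> cmod (a w) * exp (- (2 * s powr (- \<rho>)))"
    by (intro mult_left_mono) auto
  then have "1 \<le> cmod (a w) * exp (- (2 * s powr (- \<rho>)))" using w(2) by linarith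
  then have "exp (2 * s powr (- \<rho>)) \<le> cmod (a w)" by (simp add: exp_minus field_simps)
  then have "2 * s powr (- \<rho>) \<le> ln (cmod (a w))" using \<open>a w \<noteq> 0\<close> by (simp add: ln_ge_iff)
  with upper have "2 * s powr (- \<rho>) \<le> C * (4 / 3) powr \<rho> * s powr \<epsilon> * s powr (- \<rho>)" by linarith
  then show ?thesis using s by (simp add: s_def)
qed

theorem theorem7:
  fixes \<rho> :: real
  assumes "\<rho> > 0"
  shows "\<exists>z :: nat \<Rightarrow> complex.
           inj z \<and> range z \<subseteq> unit_disc \<and>
           (\<exists>C::real. C > 0 \<and>
              (\<forall>k. integrated_counting z (z k) ((1 - cmod (z k)) / 2)
                     \<le> ennreal (C * (1 / (1 - cmod (z k))) powr \<rho>))) \<and>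
           (\<forall>(\<epsilon>0::real) (a :: complex \<Rightarrow> complex).
              \<epsilon>0 > 0 \<longrightarrow> a analytic_on unit_disc \<longrightarrow>
              (\<exists>C'::real. C' > 0 \<and>
                 (\<forall>r\<in>{0..<1}. ln_max_modulus r a \<le> ereal (C' * (1 - r) powr (- \<rho> + \<epsilon>0)))) \<longrightarrow>
              \<not> (\<exists>f. solution_in_disc a f \<and> zero_sequence_of z f))"
proof (intro exI[of _ "pair_sequence \<rho>"] conjI allI impI)
  show "inj (pair_sequence \<rho>)" by (rule inj_pair_sequence)
  show "range (pair_sequence \<rho>) \<subseteq> unit_disc"
    using boundary_distance_pos by (auto simp: norm_pair_sequence)
  show "\<exists>C::real. C > 0 \<and> (\<forall>k. integrated_counting (pair_sequence \<rho>) (pair_sequence \<rho> k)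
      ((1 - cmod (pair_sequence \<rho> k)) / 2) \<le> ennreal (C * (1 / (1 - cmod (pair_sequence \<rho> k))) powr \<rho>))"
    using integrated_counting_pair_sequence[OF assms] by (intro exI[of _ 2]) auto
next
  fix \<epsilon>0 :: real and a :: "complex \<Rightarrow> complex"
  assume \<epsilon>: "\<epsilon>0 > 0" and a: "a analytic_on unit_disc"
    and "\<exists>C'::real. C' > 0 \<and>
      (\<forall>r\<in>{0..<1}. ln_max_modulus r a \<le> ereal (C' * (1 - r) powr (- \<rho> + \<epsilon>0)))"
  then obtain C where C: "C > 0"
    "\<forall>r\<in>{0..<1}. ln_max_modulus r a \<le> ereal (C * (1 - r) powr (- \<rho> + \<epsilon>0))" by blast
  show "\<not> (\<exists>f. solution_in_disc a f \<and> zero_sequence_of (pair_sequence \<rho>) f)"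
  proof
    assume "\<exists>f. solution_in_disc a f \<and> zero_sequence_of (pair_sequence \<rho>) f"
    then obtain f where "solution_in_disc a f" "zero_sequence_of (pair_sequence \<rho>) f" by blast
    then have "2 \<le> C * (4 / 3) powr \<rho> * block_scale n powr \<epsilon>0" for n
      using pair_sequence_coefficient_lower_bound[OF assms a C] \<epsilon> by blast
    moreover have "(\<lambda>n. C * (4 / 3) powr \<rho> * block_scale n powr \<epsilon>0) \<longlonglongrightarrow> C * (4 / 3) powr \<rho> * 0"
      using \<epsilon> block_scale_tendsto block_scale_pos
      by (intro tendsto_mult_left tendsto_zero_powrI) (auto intro!: always_eventually less_imp_le)
    ultimately have "2 \<le> C * (4 / 3) powr \<rho> * 0"
      by (intro LIMSEQ_le_const) auto
    then show False by simp
  qed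
qed

end
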